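(* Let $F$ be the free monoid on one generator, let $G$ be the infinite cyclic group regarded as an object of $\mathsf{AtoMon}$, and for every positive integer $n$ fix a set $X_n=\{x_1,\dots,x_n\}$ with $n$ elements. For distinct words $\omega_1,\omega_2$ of length at least two in the free monoid $\mathsf{F}(X_n)$, let $M(X_n;\omega_1,\omega_2):=\langle X_n\mid \omega_1=\omega_2\rangle$. Then the set $$\mathcal{G}:=\{F,G\}\cup\left\{M(X_n;\omega_1,\omega_2): n\in\mathbb{N}^+,\ \omega_1,\omega_2\in \mathsf{F}(X_n),\ \omega_1\neq\omega_2,\ |\omega_1|\geq 2,\ |\omega_2|\geq 2\right\}$$ is a strong generator for $\mathsf{AtoMon}$.
   Context: Monoids are not assumed to be commutative. For a monoid $H$, $H^\times$ denotes its group of units. A non-unit $a\in H$ is an atom if every equality $a=xy$ with $x,y\in H$ implies $x\in H^\times$ or $y\in H^\times$; $\mathcal{A}(H)$ denotes the set of atoms of $H$. The monoid $H$ is atomic if every non-unit of $H$ is a finite non-empty product of atoms. A homomorphism $f\colon H\to K$ between atomic monoids is atom-preserving if $f(\mathcal{A}(H))\subseteq\mathcal{A}(K)$. $\mathsf{AtoMon}$ is the category with objects the atomic monoids and morphisms the atom-preserving monoid homomorphisms. For a set $X$, $\mathsf{F}(X)$ is the free monoid on $X$ (finite words in $X$), $|\omega|$ is the length of a word $\omega$, and $\langle X\mid\mathcal{R}\rangle$ is the quotient of $\mathsf{F}(X)$ by the smallest monoid congruence containing the relations in $\mathcal{R}$. The monoids $M(X_n;\omega_1,\omega_2)$ above are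 objects of $\mathsf{AtoMon}$. A set $\mathcal{G}$ of objects of a category $\mathcal{C}$ is a generator for $\mathcal{C}$ if for each pair of distinct morphisms $f_1,f_2\colon K\to K'$ there exist an object $G\in\mathcal{G}$ and a morphism $g\colon G\to K$ with $f_1g\neq f_2g$. A generator $\mathcal{G}$ is strong if for each object $K$ and each proper subobject of $K$ (i.e. each monomorphism $m$ into $K$ which is not an isomorphism) there exists a morphism $G\to K$ with $G\in\mathcal{G}$ which does not factor through that subobject. *)

theory Defs
  imports "HOL-Algebra.Elementary_Groups" "HOL-Library.Countable_Set" "HOL-Library.Infinite_Typeclass"
begin

section \<open>Categories, generators and strong generators\<close>

text \<open>
  Morphisms live in hom-sets indexed by source and target, so a morphism is determined by an
  element of \<open>Hom C A B\<close> together with \<open>A\<close> and \<open>B\<close>.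
  \<open>Comp C A g f\<close> is \<open>g\<close> after \<open>f\<close>, where \<open>A\<close> is the source of \<open>f\<close>.
\<close>

record ('o, 'm) category_data =
  Obj :: "'o set"
  Hom :: "'o \<Rightarrow> 'o \<Rightarrow> 'm set"
  Ident :: "'o \<Rightarrow> 'm"
  Comp :: "'o \<Rightarrow> 'm \<Rightarrow> 'm \<Rightarrow> 'm"

definition is_category :: "('o, 'm) category_data \<Rightarrow> bool" where
  "is_category C \<longleftrightarrow>
    (\<forall>A \<in> Obj C. Ident C A \<in> Hom C A A) \<and>
    (\<forall>A \<in> Obj C. \<forall>B \<in> Obj C. \<forall>D \<in> Obj C. \<forall>f \<in> Hom C A B. \<forall>g \<in> Hom C B D.
        Comp C A g f \<in> Hom C A D) \<and>
    (\<forall>A \<in> Obj C. \<forall>B \<in> Obj C. \<forall>f \<in> Hom C A B.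
        Comp C A f (Ident C A) = f \<and> Comp C A (Ident C B) f = f) \<and>
    (\<forall>A \<in> Obj C. \<forall>B \<in> Obj C. \<forall>D \<in> Obj C. \<forall>E \<in> Obj C.
       \<forall>f \<in> Hom C A B. \<forall>g \<in> Hom C B D. \<forall>h \<in> Hom C D E.
        Comp C A h (Comp C A g f) = Comp C A (Comp C B h g) f)"

definition monomorphism :: "('o, 'm) category_data \<Rightarrow> 'o \<Rightarrow> 'o \<Rightarrow> 'm \<Rightarrow> bool" where
  "monomorphism C A B m \<longleftrightarrow> m \<in> Hom C A B \<and>
    (\<forall>Z \<in> Obj C. \<forall>g \<in> Hom C Z A. \<forall>h \<in> Hom C Z A. Comp C Z m g = Comp C Z m h \<longrightarrow> g = h)"

definition isomorphism :: "('o, 'm) category_data \<Rightarrow> 'o \<Rightarrow> 'o \<Rightarrow> 'm \<Rightarrow> bool" where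
  "isomorphism C A B f \<longleftrightarrow> f \<in> Hom C A B \<and>
    (\<exists>g \<in> Hom C B A. Comp C A g f = Ident C A \<and> Comp C B f g = Ident C B)"

definition generator :: "('o, 'm) category_data \<Rightarrow> 'o set \<Rightarrow> bool" where
  "generator C \<G> \<longleftrightarrow> \<G> \<subseteq> Obj C \<and>
    (\<forall>K \<in> Obj C. \<forall>K' \<in> Obj C. \<forall>f1 \<in> Hom C K K'. \<forall>f2 \<in> Hom C K K'. f1 \<noteq> f2 \<longrightarrow>
       (\<exists>G \<in> \<G>. \<exists>g \<in> Hom C G K. Comp C G f1 g \<noteq> Comp C G f2 g))"

definition strong_generator :: "('o, 'm) category_data \<Rightarrow> 'o set \<Rightarrow> bool" where
  "strong_generator C \<G> \<longleftrightarrow> generator C \<G> \<and>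
    (\<forall>K \<in> Obj C. \<forall>L \<in> Obj C. \<forall>m. monomorphism C L K m \<and> \<not> isomorphism C L K m \<longrightarrow>
       (\<exists>G \<in> \<G>. \<exists>g \<in> Hom C G K. \<not> (\<exists>h \<in> Hom C G L. Comp C G m h = g)))"

section \<open>The category of atomic monoids\<close>

definition atoms :: "('a, 'b) monoid_scheme \<Rightarrow> 'a set" where
  "atoms H = {a \<in> carrier H - Units H.
     \<forall>x \<in> carrier H. \<forall>y \<in> carrier H. a = x \<otimes>\<^bsub>H\<^esub> y \<longrightarrow> x \<in> Units H \<or> y \<in> Units H}"

definition atomic_monoid :: "('a, 'b) monoid_scheme \<Rightarrow> bool" where
  "atomic_monoid H \<longleftrightarrow> monoid H \<and>
    (\<forall>a \<in> carrier H - Units H.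
       \<exists>as. as \<noteq> [] \<and> set as \<subseteq> atoms H \<and> a = foldr (mult H) as \<one>\<^bsub>H\<^esub>)"

text \<open>
  Preservation of the unit is not part of the library's \<^const>\<open>hom\<close>. Homomorphisms are
  taken \<^const>\<open>extensional\<close>, so that two of them are equal as HOL functions iff they agree
  on the carrier of their source.
\<close>

definition atom_preserving_hom ::
  "('a, 'c) monoid_scheme \<Rightarrow> ('b, 'd) monoid_scheme \<Rightarrow> ('a \<Rightarrow> 'b) set" where
  "atom_preserving_hom H K =
     {f \<in> hom H K \<inter> extensional (carrier H). f \<one>\<^bsub>H\<^esub> = \<one>\<^bsub>K\<^esub> \<and> f ` atoms H \<subseteq> atoms K}"

text \<open>
  The type \<open>'u\<close> plays the role of the universe: the objects are all atomic monoids whose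
  underlying set is a set of elements of \<open>'u\<close>.
\<close>

definition AtoMon :: "('u monoid, 'u \<Rightarrow> 'u) category_data" where
  "AtoMon =
    \<lparr>Obj = {H. atomic_monoid H},
     Hom = atom_preserving_hom,
     Ident = (\<lambda>H. \<lambda>x \<in> carrier H. x),
     Comp = (\<lambda>H g f. compose (carrier H) g f)\<rparr>"

lemma atom_preserving_homD:
  assumes "f \<in> atom_preserving_hom A B"
  shows "f \<in> carrier A \<rightarrow> carrier B" "f \<in> extensional (carrier A)"
  using assms by (simp_all add: atom_preserving_hom_def hom_def)

lemma atom_preserving_hom_id:
  assumes "atomic_monoid A"
  shows "(\<lambda>x \<in> carrier A. x) \<in> atom_preserving_hom A A"
proof -
  interpret monoid A using assms by (simp add: atomic_monoid_def)
  show ?thesis by (auto simp: atom_preserving_hom_def hom_def atoms_def)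
qed

lemma atom_preserving_hom_compose:
  assumes "atomic_monoid A" "f \<in> atom_preserving_hom A B" "g \<in> atom_preserving_hom B D"
  shows "compose (carrier A) g f \<in> atom_preserving_hom A D"
proof -
  interpret monoid A using assms by (simp add: atomic_monoid_def)
  have "atoms A \<subseteq> carrier A" by (auto simp: atoms_def)
  then show ?thesis using assms(2,3)
    by (auto simp: atom_preserving_hom_def hom_def compose_def Pi_iff image_subset_iff)
qed

lemma is_category_AtoMon: "is_category AtoMon"
  unfolding is_category_def AtoMon_def category_data.simps mem_Collect_eq
proof (intro conjI ballI)
  fix A B D E :: "'a monoid" and f g h
  assume f: "f \<in> atom_preserving_hom A B"
  show "compose (carrier A) f (\<lambda>x \<in> carrier A. x) = f"
    and "compose (carrier A) (\<lambda>x \<in> carrier B. x) f = f"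
    and "compose (carrier A) h (compose (carrier A) g f) =
         compose (carrier A) (compose (carrier B) h g) f"
    using atom_preserving_homD[OF f] by (auto intro: compose_Id Id_compose compose_assoc)
qed (auto intro: atom_preserving_hom_id atom_preserving_hom_compose)

section \<open>Free monoids and presentations\<close>

definition free_monoid :: "'a set \<Rightarrow> 'a list monoid" where
  "free_monoid X = \<lparr>carrier = lists X, mult = (@), one = []\<rparr>"

definition monoid_congruence :: "('a, 'b) monoid_scheme \<Rightarrow> ('a \<times> 'a) set \<Rightarrow> bool" where
  "monoid_congruence H r \<longleftrightarrow> equiv (carrier H) r \<and>
    (\<forall>(a, a') \<in> r. \<forall>(b, b') \<in> r. (a \<otimes>\<^bsub>H\<^esub> b, a' \<otimes>\<^bsub>H\<^esub> b') \<in> r)"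

definition generated_congruence :: "('a, 'b) monoid_scheme \<Rightarrow> ('a \<times> 'a) set \<Rightarrow> ('a \<times> 'a) set" where
  "generated_congruence H R = \<Inter>{r. monoid_congruence H r \<and> R \<subseteq> r}"

definition quotient_monoid :: "('a, 'b) monoid_scheme \<Rightarrow> ('a \<times> 'a) set \<Rightarrow> 'a set monoid" where
  "quotient_monoid H r =
    \<lparr>carrier = carrier H // r,
     mult = (\<lambda>A B. \<Union>a \<in> A. \<Union>b \<in> B. r `` {a \<otimes>\<^bsub>H\<^esub> b}),
     one = r `` {\<one>\<^bsub>H\<^esub>}\<rparr>"

definition presented_monoid :: "'a set \<Rightarrow> ('a list \<times> 'a list) set \<Rightarrow> 'a list set monoid" where
  "presented_monoid X R =
     quotient_monoid (free_monoid X) (generated_congruence (free_monoid X) R)"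

text \<open>The number \<open>i\<close> stands for the generator \<open>x\<^sub>i\<close>.\<close>

definition M_pres :: "nat \<Rightarrow> nat list \<Rightarrow> nat list \<Rightarrow> nat list set monoid" where
  "M_pres n \<omega>1 \<omega>2 = presented_monoid {1..n} {(\<omega>1, \<omega>2)}"

definition admissible :: "nat \<Rightarrow> nat list \<Rightarrow> nat list \<Rightarrow> bool" where
  "admissible n \<omega>1 \<omega>2 \<longleftrightarrow> 1 \<le> n \<and> \<omega>1 \<in> lists {1..n} \<and> \<omega>2 \<in> lists {1..n} \<and>
     \<omega>1 \<noteq> \<omega>2 \<and> 2 \<le> length \<omega>1 \<and> 2 \<le> length \<omega>2"

section \<open>Copies of a monoid in the universe\<close>

text \<open>
  The concrete monoids above live in various types; inside \<open>AtoMon\<close> they are represented by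
  isomorphic copies with carrier in \<open>'u\<close>. The condition \<^term>\<open>monoid K\<close> is needed since
  \<^const>\<open>is_iso\<close> only speaks about products, even for records that are not monoids.
\<close>

definition copy_of :: "('a, 'b) monoid_scheme \<Rightarrow> ('u, 'c) monoid_scheme \<Rightarrow> bool" where
  "copy_of H K \<longleftrightarrow> monoid K \<and> K \<cong> H"

lemma copy_exists:
  fixes H :: "('a, 'b) monoid_scheme"
  assumes "monoid H" "countable (carrier H)"
  shows "\<exists>K :: ('u :: infinite) monoid. copy_of H K"
proof -
  interpret H: monoid H by fact
  obtain t :: "nat \<Rightarrow> 'u" where t: "inj t"
    using infinite_countable_subset[OF infinite_UNIV] by auto
  define e where "e = t \<circ> to_nat_on (carrier H)"
  define d where "d = inv_into (carrier H) e"
  have e: "inj_on e (carrier H)"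
    unfolding e_def by (rule comp_inj_on) (use assms t in \<open>auto intro: inj_on_subset\<close>)
  then have d: "d (e x) = x" if "x \<in> carrier H" for x
    using that by (simp add: d_def)
  define K :: "'u monoid" where
    "K = \<lparr>carrier = e ` carrier H, mult = (\<lambda>x y. e (d x \<otimes>\<^bsub>H\<^esub> d y)), one = e \<one>\<^bsub>H\<^esub>\<rparr>"
  have "monoid K"
    by (rule monoidI) (auto simp: K_def d H.m_assoc)
  moreover have "d \<in> iso K H"
    using d by (auto simp: iso_def hom_def K_def bij_betw_def inj_on_def image_image)
  ultimately show ?thesis
    unfolding copy_of_def is_iso_def by blast
qed

end

theory Submission
  imports Defs
begin

text \<open>
  Units of an atomic monoid are detected by morphisms from the infinite cyclic group, atoms by
  morphisms from the free monoid on one generator, and units and atoms together generate; so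
  \<open>{F, G}\<close> is already a generator, and a monomorphism \<open>m\<close> through which every morphism from
  \<open>F\<close> and \<open>G\<close> factors is surjective, and injective on units and on atoms. Non-units map to
  non-units, because a non-empty product of atoms is never a unit (also without
  commutativity). If two products \<open>a\<^sub>1 \<cdots> a\<^sub>r\<close> and \<open>b\<^sub>1 \<cdots> b\<^sub>s\<close> of at least two atoms have the
  same image, then \<open>m(a\<^sub>1), \<dots>, m(b\<^sub>s)\<close> define a morphism on
  \<open>\<langle>x\<^sub>1, \<dots>, x\<^sub>r\<^sub>+\<^sub>s | x\<^sub>1 \<cdots> x\<^sub>r = x\<^sub>r\<^sub>+\<^sub>1 \<cdots> x\<^sub>r\<^sub>+\<^sub>s\<rangle>\<close>; its factorisation through \<open>m\<close> sends the generators
  to \<open>a\<^sub>1, \<dots>, b\<^sub>s\<close>, so the products agree already in the source.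
\<close>

section \<open>Atoms and products of atoms\<close>

lemma AtoMon_simps [simp]:
  "Obj AtoMon = {H. atomic_monoid H}"
  "Hom AtoMon = atom_preserving_hom"
  "Ident AtoMon H = (\<lambda>x \<in> carrier H. x)"
  "Comp AtoMon H g f = compose (carrier H) g f"
  by (simp_all add: AtoMon_def)

lemma atoms_closed: "a \<in> atoms H \<Longrightarrow> a \<in> carrier H"
  by (simp add: atoms_def)

lemma atoms_not_Units: "a \<in> atoms H \<Longrightarrow> a \<notin> Units H"
  by (simp add: atoms_def)

lemma atomic_monoidD: "atomic_monoid H \<Longrightarrow> monoid H"
  by (simp add: atomic_monoid_def)

lemma atomic_monoidE:
  assumes "atomic_monoid H" "x \<in> carrier H" "x \<notin> Units H"
  obtains as where "as \<noteq> []" "set as \<subseteq> atoms H" "x = foldr (mult H) as \<one>\<^bsub>H\<^esub>"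
  using assms by (auto simp: atomic_monoid_def)

lemma atom_preserving_hom_iff:
  "f \<in> atom_preserving_hom H K \<longleftrightarrow>
     f \<in> hom H K \<and> f \<in> extensional (carrier H) \<and> f \<one>\<^bsub>H\<^esub> = \<one>\<^bsub>K\<^esub> \<and> (\<forall>a \<in> atoms H. f a \<in> atoms K)"
  by (auto simp: atom_preserving_hom_def)

lemma (in monoid) foldr_mult_closed:
  "set as \<subseteq> carrier G \<Longrightarrow> foldr (\<otimes>) as \<one> \<in> carrier G"
  by (induction as) auto

lemma (in monoid) foldr_mult_append:
  assumes "set as \<subseteq> carrier G" "set bs \<subseteq> carrier G"
  shows "foldr (\<otimes>) (as @ bs) \<one> = foldr (\<otimes>) as \<one> \<otimes> foldr (\<otimes>) bs \<one>"
  using assms by (induction as) (simp_all add: foldr_mult_closed m_assoc)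

lemma hom_foldr_mult:
  assumes "monoid H" "h \<in> hom H K" "h \<one>\<^bsub>H\<^esub> = \<one>\<^bsub>K\<^esub>" "set as \<subseteq> carrier H"
  shows "h (foldr (mult H) as \<one>\<^bsub>H\<^esub>) = foldr (mult K) (map h as) \<one>\<^bsub>K\<^esub>"
  using assms(4)
  by (induction as) (simp_all add: assms(3) hom_mult[OF assms(2)] monoid.foldr_mult_closed[OF assms(1)])

text \<open>From \<open>a b = 1\<close> one gets \<open>a = a (b a)\<close>, and since
  \<open>a\<close> is an atom and not a unit, \<open>b a\<close> must be a unit. Then
  \<open>inv (b a) b\<close> is a left inverse of \<open>a\<close>; it coincides with the right
  inverse \<open>b\<close>, which makes \<open>a\<close> a unit, a contradiction. Without
  commutativity a one-sided inverse does not by itself give a unit, so the atom property has to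
  enter.\<close>

lemma (in monoid) atom_not_right_invertible:
  assumes "a \<in> atoms G" "b \<in> carrier G" "a \<otimes> b = \<one>"
  shows False
proof -
  have a: "a \<in> carrier G" "a \<notin> Units G"
    using assms(1) by (auto simp: atoms_def)
  have "a = a \<otimes> (b \<otimes> a)"
    using a assms(2,3) by (metis l_one m_assoc)
  with assms(1,2) a have "b \<otimes> a \<in> Units G"
    by (auto simp: atoms_def)
  then have "inv (b \<otimes> a) \<otimes> (b \<otimes> a) = \<one>" and c: "inv (b \<otimes> a) \<in> carrier G"
    by auto
  then have l: "(inv (b \<otimes> a) \<otimes> b) \<otimes> a = \<one>"
    using a assms(2) by (simp add: m_assoc)
  then have "inv (b \<otimes> a) \<otimes> b = b"
    using inv_unique[OF l assms(3)] a assms(2) c by simp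
  with l assms a show False
    by (auto simp: Units_def)
qed

text \<open>If \<open>a p\<close> is a unit, where \<open>a\<close> is the first atom and
  \<open>p\<close> the product of the others, then \<open>p inv (a p)\<close> is a right inverse of
  \<open>a\<close>, which no atom has.\<close>

lemma (in monoid) foldr_mult_atoms_not_Units:
  assumes "as \<noteq> []" "set as \<subseteq> atoms G"
  shows "foldr (\<otimes>) as \<one> \<notin> Units G"
proof
  assume u: "foldr (\<otimes>) as \<one> \<in> Units G"
  obtain a bs where as: "as = a # bs"
    using assms(1) by (cases as) auto
  define p where "p = foldr (\<otimes>) bs \<one>"
  have p: "p \<in> carrier G"
    unfolding p_def using assms(2) as by (intro foldr_mult_closed) (auto intro: atoms_closed)
  have a: "a \<in> atoms G" "a \<in> carrier G"
    using assms(2) as by (auto intro: atoms_closed)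
  from u have u': "a \<otimes> p \<in> Units G"
    by (simp add: as p_def)
  then have "a \<otimes> (p \<otimes> inv (a \<otimes> p)) = \<one>"
    using a p by (metis Units_inv_closed Units_r_inv m_assoc)
  then show False
    using atom_not_right_invertible[OF a(1), of "p \<otimes> inv (a \<otimes> p)"] p u' by simp
qed

text \<open>The empty product is a unit, hence not an atom. With two or more factors the product
  splits into its first atom and the product of the rest, and both are non-units.\<close>

lemma (in monoid) foldr_mult_atoms_in_atoms:
  assumes "set as \<subseteq> atoms G" "foldr (\<otimes>) as \<one> \<in> atoms G"
  obtains a where "as = [a]"
proof (cases as)
  case Nil
  with assms(2) show ?thesis by (simp add: atoms_def)
next
  case (Cons a bs)
  have "bs = []"
  proof (rule ccontr)
    assume "bs \<noteq> []"
    moreover have "set bs \<subseteq> atoms G" "set bs \<subseteq> carrier G"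
      using Cons assms(1) by (auto intro: atoms_closed)
    ultimately have "foldr (\<otimes>) bs \<one> \<notin> Units G" "foldr (\<otimes>) bs \<one> \<in> carrier G"
      by (auto intro: foldr_mult_closed dest: foldr_mult_atoms_not_Units)
    moreover have "a \<notin> Units G" "a \<in> carrier G"
      using Cons assms(1) by (auto simp: atoms_def)
    ultimately show False
      using assms(2) Cons by (auto simp: atoms_def)
  qed
  with Cons that show ?thesis by blast
qed

section \<open>Units and atoms under atom-preserving homomorphisms\<close>

lemma hom_Units:
  assumes "monoid H" "h \<in> hom H K" "h \<one>\<^bsub>H\<^esub> = \<one>\<^bsub>K\<^esub>" "u \<in> Units H"
  shows "h u \<in> Units K"
proof -
  interpret monoid H by fact
  have "u \<in> carrier H" "inv\<^bsub>H\<^esub> u \<in> carrier H" using assms(4) by auto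
  moreover have "h (inv\<^bsub>H\<^esub> u) \<otimes>\<^bsub>K\<^esub> h u = \<one>\<^bsub>K\<^esub>" "h u \<otimes>\<^bsub>K\<^esub> h (inv\<^bsub>H\<^esub> u) = \<one>\<^bsub>K\<^esub>"
    using calculation assms by (simp_all add: hom_mult[symmetric])
  ultimately show ?thesis
    using assms(2) by (auto simp: Units_def hom_def)
qed

text \<open>Homomorphisms always preserve units. Conversely, a non-unit of the atomic monoid
  \<open>H\<close> is a non-empty product of atoms, so its image is one too and cannot be a
  unit.\<close>

lemma atom_preserving_hom_Units_iff:
  assumes "atomic_monoid H" "monoid K" "f \<in> atom_preserving_hom H K" "x \<in> carrier H"
  shows "f x \<in> Units K \<longleftrightarrow> x \<in> Units H"
proof
  have f: "f \<in> hom H K" "f \<one>\<^bsub>H\<^esub> = \<one>\<^bsub>K\<^esub>" "\<And>a. a \<in> atoms H \<Longrightarrow> f a \<in> atoms K"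
    using assms(3) by (auto simp: atom_preserving_hom_iff)
  note H = atomic_monoidD[OF assms(1)]
  show "f x \<in> Units K" if "x \<in> Units H"
    using hom_Units[OF H f(1,2) that] .
  show "x \<in> Units H" if fx: "f x \<in> Units K"
  proof (rule ccontr)
    assume "x \<notin> Units H"
    then obtain as where as: "as \<noteq> []" "set as \<subseteq> atoms H" "x = foldr (mult H) as \<one>\<^bsub>H\<^esub>"
      using atomic_monoidE[OF assms(1,4)] by blast
    have "f x = foldr (mult K) (map f as) \<one>\<^bsub>K\<^esub>"
      unfolding as(3) using as(2) by (intro hom_foldr_mult H f) (auto intro: atoms_closed)
    moreover have "set (map f as) \<subseteq> atoms K" using as(2) f(3) by auto
    ultimately show False
      using monoid.foldr_mult_atoms_not_Units[OF assms(2), of "map f as"] as(1) fx by simp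
  qed
qed

text \<open>Since \<open>f x\<close> is not a unit, neither is \<open>x\<close>, so \<open>x\<close>
  factors into atoms. Applying \<open>f\<close> yields a factorisation of the atom
  \<open>f x\<close> with equally many atoms, hence with exactly one.\<close>

lemma atom_preserving_hom_atomsD:
  assumes "atomic_monoid H" "monoid K" "f \<in> atom_preserving_hom H K" "x \<in> carrier H"
    "f x \<in> atoms K"
  shows "x \<in> atoms H"
proof -
  have f: "f \<in> hom H K" "f \<one>\<^bsub>H\<^esub> = \<one>\<^bsub>K\<^esub>" "\<And>a. a \<in> atoms H \<Longrightarrow> f a \<in> atoms K"
    using assms(3) by (auto simp: atom_preserving_hom_iff)
  note H = atomic_monoidD[OF assms(1)]
  have "x \<notin> Units H"
    using atom_preserving_hom_Units_iff[OF assms(1-4)] atoms_not_Units[OF assms(5)] by simp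
  then obtain as where as: "as \<noteq> []" "set as \<subseteq> atoms H" "x = foldr (mult H) as \<one>\<^bsub>H\<^esub>"
    using atomic_monoidE[OF assms(1,4)] by blast
  have fx: "f x = foldr (mult K) (map f as) \<one>\<^bsub>K\<^esub>"
    unfolding as(3) using as(2) by (intro hom_foldr_mult H f) (auto intro: atoms_closed)
  have "set (map f as) \<subseteq> atoms K" using as(2) f(3) by auto
  moreover have "foldr (mult K) (map f as) \<one>\<^bsub>K\<^esub> \<in> atoms K" using assms(5) fx by simp
  ultimately obtain b where "map f as = [b]"
    by (rule monoid.foldr_mult_atoms_in_atoms[OF assms(2)])
  then obtain a where "as = [a]" by auto
  with as show ?thesis
    using monoid.r_one[OF H, of a] by (simp add: atoms_closed)
qed

text \<open>Every element of an atomic monoid is a unit or a product of atoms, so a morphism is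
  determined by its values on these two kinds of elements.\<close>

lemma atom_preserving_hom_eqI:
  assumes "atomic_monoid H"
    and f: "f \<in> atom_preserving_hom H K" and g: "g \<in> atom_preserving_hom H K"
    and units: "\<And>u. u \<in> Units H \<Longrightarrow> f u = g u"
    and atoms: "\<And>a. a \<in> atoms H \<Longrightarrow> f a = g a"
  shows "f = g"
proof (rule extensionalityI)
  show "f \<in> extensional (carrier H)" "g \<in> extensional (carrier H)"
    using f g by (auto simp: atom_preserving_hom_iff)
  note H = atomic_monoidD[OF assms(1)]
  fix x assume x: "x \<in> carrier H"
  show "f x = g x"
  proof (cases "x \<in> Units H")
    case False
    then obtain as where as: "set as \<subseteq> atoms H" "x = foldr (mult H) as \<one>\<^bsub>H\<^esub>"
      using atomic_monoidE[OF assms(1) x] by blast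
    have "map f as = map g as" using atoms as(1) by auto
    moreover have "set as \<subseteq> carrier H" using as(1) by (auto intro: atoms_closed)
    ultimately show ?thesis
      using f g hom_foldr_mult[OF H, of f K as] hom_foldr_mult[OF H, of g K as]
      by (simp add: as(2) atom_preserving_hom_iff del: map_eq_conv)
  qed (rule units)
qed

text \<open>The point to check is that the inverse homomorphism preserves atoms, which holds because
  atom-preserving homomorphisms out of an atomic monoid reflect atoms.\<close>

lemma bijective_isomorphism_AtoMon:
  assumes L: "atomic_monoid L" and K: "monoid K"
    and f: "f \<in> atom_preserving_hom L K" and bij: "bij_betw f (carrier L) (carrier K)"
  shows "isomorphism AtoMon L K f"
proof -
  interpret L: monoid L using L by (rule atomic_monoidD)
  interpret K: monoid K by (rule K)
  \<comment> \<open>The restriction to \<open>carrier K\<close> makes the inverse extensional, as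
    membership in the hom-set demands.\<close>
  define g where "g = (\<lambda>y \<in> carrier K. inv_into (carrier L) f y)"
  have fg: "f (g y) = y" "g y \<in> carrier L" if "y \<in> carrier K" for y
    using that bij by (auto simp: g_def bij_betw_def inv_into_into f_inv_into_f)
  have gf: "g (f x) = x" if "x \<in> carrier L" for x
    using that bij by (auto simp: g_def bij_betw_def)
  have fc: "f x \<in> carrier K" if "x \<in> carrier L" for x
    using that bij by (auto simp: bij_betw_def)
  have fh: "f \<in> hom L K" "f \<one>\<^bsub>L\<^esub> = \<one>\<^bsub>K\<^esub>"
    using f by (auto simp: atom_preserving_hom_iff)
  have "g \<in> hom K L"
  proof (rule homI)
    fix x y assume xy: "x \<in> carrier K" "y \<in> carrier K"
    then have "g (x \<otimes>\<^bsub>K\<^esub> y) = g (f (g x \<otimes>\<^bsub>L\<^esub> g y))"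
      by (simp add: hom_mult[OF fh(1)] fg)
    then show "g (x \<otimes>\<^bsub>K\<^esub> y) = g x \<otimes>\<^bsub>L\<^esub> g y"
      using xy by (simp add: gf fg)
  qed (rule fg)
  moreover have "g \<one>\<^bsub>K\<^esub> = \<one>\<^bsub>L\<^esub>" using gf[of "\<one>\<^bsub>L\<^esub>"] fh by simp
  moreover have "g a \<in> atoms L" if a: "a \<in> atoms K" for a
    using atoms_closed[OF a] a
    by (intro atom_preserving_hom_atomsD[OF L K f]) (simp_all add: fg)
  ultimately have "g \<in> atom_preserving_hom K L"
    by (auto simp: atom_preserving_hom_iff g_def)
  moreover have "compose (carrier L) g f = (\<lambda>x \<in> carrier L. x)"
    "compose (carrier K) f g = (\<lambda>x \<in> carrier K. x)"
    by (auto simp: compose_def fun_eq_iff gf fg)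
  ultimately show ?thesis
    using f by (auto simp: isomorphism_def)
qed

section \<open>Copies of the probing monoids\<close>

text \<open>Inverts the isomorphism contained in \<open>copy_of\<close>: the arguments below push
  words and integers forward into the copy.\<close>

lemma copy_ofE:
  assumes "copy_of H K"
  obtains \<psi> where "\<psi> \<in> hom H K" "bij_betw \<psi> (carrier H) (carrier K)"
proof -
  from assms obtain f where f: "f \<in> iso K H" and K: "monoid K"
    by (auto simp: copy_of_def is_iso_def)
  interpret K: monoid K by (rule K)
  let ?g = "inv_into (carrier K) f"
  have fh: "f \<in> hom K H" and fb: "bij_betw f (carrier K) (carrier H)"
    using f by (auto simp: iso_def)
  have gb: "bij_betw ?g (carrier H) (carrier K)"
    using fb by (rule bij_betw_inv_into)
  have fg: "f (?g y) = y" if "y \<in> carrier H" for y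
    using that fb by (simp add: bij_betw_def f_inv_into_f)
  have gc: "?g y \<in> carrier K" if "y \<in> carrier H" for y
    using that gb by (auto simp: bij_betw_def)
  have "?g \<in> hom H K"
  proof (rule homI)
    fix x y assume xy: "x \<in> carrier H" "y \<in> carrier H"
    then have "?g (x \<otimes>\<^bsub>H\<^esub> y) = ?g (f (?g x \<otimes>\<^bsub>K\<^esub> ?g y))"
      by (simp add: hom_mult[OF fh] fg gc)
    then show "?g (x \<otimes>\<^bsub>H\<^esub> y) = ?g x \<otimes>\<^bsub>K\<^esub> ?g y"
      using xy fb gc by (simp add: bij_betw_def)
  qed (rule gc)
  with gb that show ?thesis by blast
qed

text \<open>For a preimage \<open>z\<close> of the identity,
  \<open>h 1 = h 1 h z = h (1 z) = h z\<close>, which is the identity. This is needed because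
  \<open>hom\<close> only speaks about products.\<close>

lemma surj_hom_one:
  assumes "monoid H" "monoid K" "h \<in> hom H K" "h ` carrier H = carrier K"
  shows "h \<one>\<^bsub>H\<^esub> = \<one>\<^bsub>K\<^esub>"
proof -
  interpret H: monoid H by fact
  interpret K: monoid K by fact
  obtain z where z: "z \<in> carrier H" "h z = \<one>\<^bsub>K\<^esub>"
    using assms(4) by (metis K.one_closed imageE)
  have "h \<one>\<^bsub>H\<^esub> = h \<one>\<^bsub>H\<^esub> \<otimes>\<^bsub>K\<^esub> h z"
    using assms(4) z by (metis H.one_closed K.r_one imageI)
  also have "\<dots> = h z" using z hom_mult[OF assms(3), of "\<one>\<^bsub>H\<^esub>" z] by simp
  finally show ?thesis using z by simp
qed

text \<open>With \<open>t\<close> the image of the integer 1, evaluation at \<open>t\<close> is a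
  bijection from the morphisms \<open>G\<close> to \<open>N\<close> onto the units of
  \<open>N\<close>. As \<open>G\<close> consists of units, it has no atoms; hence it is atomic and
  atom preservation holds vacuously.\<close>

lemma integer_group_copy:
  assumes "copy_of integer_group G"
  obtains t where "atomic_monoid G"
    "\<And>(N :: ('n, 'c) monoid_scheme) f g. monoid N \<Longrightarrow> f \<in> atom_preserving_hom G N \<Longrightarrow>
       g \<in> atom_preserving_hom G N \<Longrightarrow> f t = g t \<Longrightarrow> f = g"
    "\<And>(N :: ('n, 'c) monoid_scheme) u. monoid N \<Longrightarrow> u \<in> Units N \<Longrightarrow>
       \<exists>f \<in> atom_preserving_hom G N. f t = u"
    "t \<in> Units G"
proof -
  have "monoid G" using assms by (simp add: copy_of_def)
  then interpret G: monoid G .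
  obtain \<psi> where \<psi>: "\<psi> \<in> hom integer_group G" and b: "bij_betw \<psi> UNIV (carrier G)"
    using copy_ofE[OF assms] by auto
  have one: "\<psi> 0 = \<one>\<^bsub>G\<^esub>"
    using surj_hom_one[OF group.is_monoid[OF group_integer_group] \<open>monoid G\<close> \<psi>] b
    by (simp add: bij_betw_def)
  have c: "\<psi> k \<in> carrier G" for k using b by (auto simp: bij_betw_def)
  have add: "\<psi> (j + k) = \<psi> j \<otimes>\<^bsub>G\<^esub> \<psi> k" for j k
    using hom_mult[OF \<psi>, of j k] by simp
  have unit: "\<psi> k \<in> Units G" for k
  proof -
    have "\<psi> (- k) \<otimes>\<^bsub>G\<^esub> \<psi> k = \<one>\<^bsub>G\<^esub>" "\<psi> k \<otimes>\<^bsub>G\<^esub> \<psi> (- k) = \<one>\<^bsub>G\<^esub>"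
      by (simp_all add: one flip: add)
    with c show ?thesis by (auto simp: Units_def)
  qed
  have U: "Units G = carrier G"
  proof (intro equalityI subsetI)
    fix x assume "x \<in> carrier G"
    then obtain k where "x = \<psi> k" using b by (auto simp: bij_betw_def)
    then show "x \<in> Units G" using unit by simp
  qed (simp add: Units_def)
  then have noatoms: "atoms G = {}" by (auto simp: atoms_def)
  show thesis
  proof (rule that)
    show "atomic_monoid G"
      by (simp add: atomic_monoid_def U \<open>monoid G\<close>)
    show "\<psi> 1 \<in> Units G" by (simp add: U c)
  next
    fix N :: "('n, 'c) monoid_scheme" and f g
    assume N: "monoid N" and f: "f \<in> atom_preserving_hom G N" and g: "g \<in> atom_preserving_hom G N"
      and eq: "f (\<psi> 1) = g (\<psi> 1)"
    interpret N: monoid N by (rule N)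
    have fg: "f \<in> hom G N" "g \<in> hom G N" "f \<one>\<^bsub>G\<^esub> = \<one>\<^bsub>N\<^esub>" "g \<one>\<^bsub>G\<^esub> = \<one>\<^bsub>N\<^esub>"
      "f \<in> extensional (carrier G)" "g \<in> extensional (carrier G)"
      using f g by (auto simp: atom_preserving_hom_iff)
    have fadd: "f (\<psi> (j + k)) = f (\<psi> j) \<otimes>\<^bsub>N\<^esub> f (\<psi> k)" "g (\<psi> (j + k)) = g (\<psi> j) \<otimes>\<^bsub>N\<^esub> g (\<psi> k)" for j k
      by (simp_all add: add hom_mult[OF fg(1)] hom_mult[OF fg(2)] c)
    \<comment> \<open>Both sides are inverses of the common value at \<open>\<psi> 1\<close>, one
      from the left and one from the right. This provides the downward step of the induction over
      the integers.\<close>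
    have inv: "f (\<psi> (- 1)) = g (\<psi> (- 1))"
    proof (rule N.inv_unique)
      show "f (\<psi> (- 1)) \<otimes>\<^bsub>N\<^esub> f (\<psi> 1) = \<one>\<^bsub>N\<^esub>"
        using fadd(1)[of "- 1" 1] by (simp add: one fg)
      show "f (\<psi> 1) \<otimes>\<^bsub>N\<^esub> g (\<psi> (- 1)) = \<one>\<^bsub>N\<^esub>"
        using fadd(2)[of 1 "- 1"] by (simp add: one fg eq)
    qed (use fg c in \<open>auto simp: hom_def\<close>)
    have "f (\<psi> k) = g (\<psi> k)" for k
    proof (induction k rule: int_induct[where k = 0])
      case base
      show ?case by (simp add: one fg)
    next
      case (step1 i)
      then show ?case by (simp add: fadd eq)
    next
      case (step2 i)
      then show ?case using fadd[of i "- 1"] by (simp add: inv)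
    qed
    moreover have "carrier G = range \<psi>" using b by (simp add: bij_betw_def)
    ultimately show "f = g"
      using fg(5,6) by (intro extensionalityI[of _ "carrier G"]) auto
  next
    fix N :: "('n, 'c) monoid_scheme" and u
    assume N: "monoid N" and u: "u \<in> Units N"
    interpret N: monoid N by (rule N)
    \<comment> \<open>Negative powers of \<open>u\<close> are formed in the group of units of
      \<open>N\<close>, whose product is that of \<open>N\<close>.\<close>
    interpret U: group "units_of N" by (rule N.units_group)
    let ?p = "\<lambda>k :: int. u [^]\<^bsub>units_of N\<^esub> k"
    define f where "f = (\<lambda>x \<in> carrier G. ?p (inv_into UNIV \<psi> x))"
    have u': "u \<in> carrier (units_of N)" using u by (simp add: units_of_carrier)
    have f\<psi>: "f (\<psi> k) = ?p k" for k
      using b c by (simp add: f_def bij_betw_def)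
    have pc: "?p k \<in> carrier N" for k
      using U.int_pow_closed[OF u', of k] by (auto simp: units_of_carrier)
    have "f \<in> hom G N"
    proof (rule homI)
      fix x assume "x \<in> carrier G"
      then show "f x \<in> carrier N" by (simp add: f_def pc)
    next
      fix x y assume "x \<in> carrier G" "y \<in> carrier G"
      then obtain j k where "x = \<psi> j" "y = \<psi> k"
        using b unfolding bij_betw_def by (metis imageE)
      then show "f (x \<otimes>\<^bsub>G\<^esub> y) = f x \<otimes>\<^bsub>N\<^esub> f y"
        by (simp add: add[symmetric] f\<psi> U.int_pow_mult[OF u'] units_of_mult)
    qed
    moreover have "f \<one>\<^bsub>G\<^esub> = \<one>\<^bsub>N\<^esub>"
      by (simp add: one[symmetric] f\<psi> units_of_one)
    ultimately have "f \<in> atom_preserving_hom G N"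
      by (simp add: atom_preserving_hom_iff noatoms f_def)
    moreover have "f (\<psi> 1) = u"
      by (simp add: f\<psi> U.int_pow_1[OF u'])
    ultimately show "\<exists>f \<in> atom_preserving_hom G N. f (\<psi> 1) = u" by blast
  qed
qed

section \<open>Quotients of free monoids that identify only words of length at least two\<close>

lemma free_monoid_simps [simp]:
  "carrier (free_monoid X) = lists X" "mult (free_monoid X) = (@)" "one (free_monoid X) = []"
  by (simp_all add: free_monoid_def)

lemma monoid_free_monoid: "monoid (free_monoid X)"
  by (rule monoidI) auto

text \<open>Both the copies of \<open>F\<close> and those of the \<open>M(X\<^sub>n; \<omega>\<^sub>1, \<omega>\<^sub>2)\<close> are of this form; the length
  condition is what turns the generators into atoms and leaves \<open>\<one>\<close> as the only unit.\<close>

locale length_two_quotient = monoid K for K (structure) +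
  fixes X :: "'x set" and \<phi> :: "'x list \<Rightarrow> 'a"
  assumes \<phi>_hom: "\<phi> \<in> hom (free_monoid X) K"
    and \<phi>_surj: "\<phi> ` lists X = carrier K"
    and \<phi>_eqD: "\<lbrakk>u \<in> lists X; v \<in> lists X; \<phi> u = \<phi> v\<rbrakk> \<Longrightarrow> u = v \<or> 2 \<le> length u \<and> 2 \<le> length v"
begin

lemma \<phi>_Nil: "\<phi> [] = \<one>"
  using surj_hom_one[OF monoid_free_monoid monoid_axioms \<phi>_hom] \<phi>_surj by simp

lemma \<phi>_append: "u \<in> lists X \<Longrightarrow> v \<in> lists X \<Longrightarrow> \<phi> (u @ v) = \<phi> u \<otimes> \<phi> v"
  using hom_mult[OF \<phi>_hom, of u v] by simp

lemma \<phi>_closed: "u \<in> lists X \<Longrightarrow> \<phi> u \<in> carrier K"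
  using \<phi>_surj by auto

text \<open>Empty and one-letter words are alone in their fibres, so equations in \<open>K\<close>
  with such a right-hand side can be solved in the free monoid.\<close>

lemma \<phi>_short_eqD: "u \<in> lists X \<Longrightarrow> v \<in> lists X \<Longrightarrow> \<phi> u = \<phi> v \<Longrightarrow> length v < 2 \<Longrightarrow> u = v"
  using \<phi>_eqD by fastforce

lemma Units_eq: "Units K = {\<one>}"
proof -
  have "x = \<one>" if "x \<in> Units K" for x
  proof -
    from that obtain y where xy: "x \<in> carrier K" "y \<in> carrier K" "x \<otimes> y = \<one>"
      by (auto simp: Units_def)
    then obtain u v where uv: "u \<in> lists X" "v \<in> lists X" "x = \<phi> u" "y = \<phi> v"
      using \<phi>_surj by (metis imageE)
    then have "\<phi> (u @ v) = \<phi> []" using xy by (simp add: \<phi>_append \<phi>_Nil)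
    then have "u @ v = []" using uv by (intro \<phi>_short_eqD) auto
    then show ?thesis using uv \<phi>_Nil by simp
  qed
  then show ?thesis by auto
qed

text \<open>A factorisation of \<open>\<phi> [x]\<close> lifts to words \<open>u\<close>,
  \<open>v\<close> with \<open>u @ v = [x]\<close>, so one of the two words is empty.\<close>

lemma \<phi>_singleton_in_atoms:
  assumes "x \<in> X"
  shows "\<phi> [x] \<in> atoms K"
  unfolding atoms_def mem_Collect_eq Units_eq
proof (intro conjI ballI impI)
  have "\<phi> [x] \<noteq> \<phi> []" using assms \<phi>_short_eqD[of "[x]" "[]"] by auto
  then show "\<phi> [x] \<in> carrier K - {\<one>}" using assms by (simp add: \<phi>_closed \<phi>_Nil)
  fix y z assume yz: "y \<in> carrier K" "z \<in> carrier K" "\<phi> [x] = y \<otimes> z"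
  then obtain u v where uv: "u \<in> lists X" "v \<in> lists X" "y = \<phi> u" "z = \<phi> v"
    using \<phi>_surj by (metis imageE)
  then have "\<phi> (u @ v) = \<phi> [x]" using yz by (simp add: \<phi>_append)
  then have "u @ v = [x]" using uv assms by (intro \<phi>_short_eqD) auto
  then show "y \<in> {\<one>} \<or> z \<in> {\<one>}" using uv \<phi>_Nil by (auto simp: append_eq_Cons_conv)
qed

lemma \<phi>_Cons: "x \<in> X \<Longrightarrow> w \<in> lists X \<Longrightarrow> \<phi> (x # w) = \<phi> [x] \<otimes> \<phi> w"
  using \<phi>_append[of "[x]" w] by simp

lemma \<phi>_conv_foldr:
  "w \<in> lists X \<Longrightarrow> \<phi> w = foldr (\<otimes>) (map (\<lambda>x. \<phi> [x]) w) \<one>"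
proof (induction w)
  case (Cons x w)
  then show ?case by (simp add: \<phi>_Cons[of x w])
qed (simp add: \<phi>_Nil)

text \<open>The letters of a word representing \<open>a\<close> give a factorisation of
  \<open>a\<close> into atoms, and such a factorisation of an atom has length one.\<close>

lemma atomsE:
  assumes "a \<in> atoms K"
  obtains x where "x \<in> X" "a = \<phi> [x]"
proof -
  obtain w where w: "w \<in> lists X" "a = \<phi> w"
    using atoms_closed[OF assms] \<phi>_surj by blast
  have "set (map (\<lambda>x. \<phi> [x]) w) \<subseteq> atoms K"
    using w(1) \<phi>_singleton_in_atoms by auto
  moreover have "foldr (\<otimes>) (map (\<lambda>x. \<phi> [x]) w) \<one> \<in> atoms K"
    using assms w by (simp add: \<phi>_conv_foldr[symmetric])
  ultimately obtain b where "map (\<lambda>x. \<phi> [x]) w = [b]"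
    by (rule foldr_mult_atoms_in_atoms)
  then obtain x where "w = [x]" by auto
  with w that show ?thesis by auto
qed

lemma atomic: "atomic_monoid K"
  unfolding atomic_monoid_def
proof (intro conjI ballI)
  fix a assume a: "a \<in> carrier K - Units K"
  then obtain w where w: "w \<in> lists X" "a = \<phi> w" using \<phi>_surj by blast
  then have "w \<noteq> []" using a \<phi>_Nil by (auto simp: Units_eq)
  moreover have "set (map (\<lambda>x. \<phi> [x]) w) \<subseteq> atoms K"
    using w(1) \<phi>_singleton_in_atoms by auto
  ultimately show "\<exists>as. as \<noteq> [] \<and> set as \<subseteq> atoms K \<and> a = foldr (\<otimes>) as \<one>"
    using \<phi>_conv_foldr[OF w(1)] w(2) by (intro exI[of _ "map (\<lambda>x. \<phi> [x]) w"]) simp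
qed (rule monoid_axioms)

lemma atom_preserving_hom_\<phi>:
  assumes "f \<in> atom_preserving_hom K N" "w \<in> lists X"
  shows "f (\<phi> w) = foldr (mult N) (map (\<lambda>x. f (\<phi> [x])) w) \<one>\<^bsub>N\<^esub>"
proof -
  have "set (map (\<lambda>x. \<phi> [x]) w) \<subseteq> carrier K"
    using assms(2) by (auto intro!: \<phi>_closed)
  then show ?thesis
    using assms \<phi>_conv_foldr[OF assms(2)]
      hom_foldr_mult[OF monoid_axioms, of f N "map (\<lambda>x. \<phi> [x]) w"]
    by (simp add: atom_preserving_hom_iff comp_def)
qed

text \<open>Universal property: the extension of \<open>p\<close> to words is constant on the fibres
  of \<phi>, hence descends to \<open>K\<close>. Atoms are preserved because every atom of
  \<open>K\<close> is the image of a letter.\<close>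

lemma ex_atom_preserving_hom:
  fixes N :: "('n, 'c) monoid_scheme"
  assumes N: "monoid N" and p: "\<And>x. x \<in> X \<Longrightarrow> p x \<in> atoms N"
    and ker: "\<And>u v. \<lbrakk>u \<in> lists X; v \<in> lists X; \<phi> u = \<phi> v\<rbrakk> \<Longrightarrow>
      foldr (mult N) (map p u) \<one>\<^bsub>N\<^esub> = foldr (mult N) (map p v) \<one>\<^bsub>N\<^esub>"
  shows "\<exists>f \<in> atom_preserving_hom K N. \<forall>x \<in> X. f (\<phi> [x]) = p x"
proof -
  interpret N: monoid N by (rule N)
  let ?e = "\<lambda>w. foldr (mult N) (map p w) \<one>\<^bsub>N\<^esub>"
  \<comment> \<open>\<open>inv_into\<close> selects an arbitrary word representing \<open>y\<close>;
    by \<open>ker\<close> the value does not depend on this choice.\<close>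
  define f where "f = (\<lambda>y \<in> carrier K. ?e (inv_into (lists X) \<phi> y))"
  have f: "f (\<phi> w) = ?e w" if "w \<in> lists X" for w
  proof -
    have "\<phi> w \<in> \<phi> ` lists X" using that by (rule imageI)
    then have "?e (inv_into (lists X) \<phi> (\<phi> w)) = ?e w"
      using that by (intro ker inv_into_into f_inv_into_f)
    then show ?thesis using that by (simp add: f_def \<phi>_closed)
  qed
  have pc: "set (map p w) \<subseteq> carrier N" if "w \<in> lists X" for w
    using that by (auto intro!: atoms_closed p)
  have gen: "f (\<phi> [x]) = p x" if "x \<in> X" for x
    using that atoms_closed[OF p[OF that]] f[of "[x]"] by simp
  have "f \<in> hom K N"
  proof (rule homI)
    fix y assume "y \<in> carrier K"
    then obtain u where "u \<in> lists X" "y = \<phi> u" using \<phi>_surj by blast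
    then show "f y \<in> carrier N" by (simp add: f N.foldr_mult_closed pc del: set_map)
  next
    fix y z assume "y \<in> carrier K" "z \<in> carrier K"
    then obtain u v where uv: "u \<in> lists X" "v \<in> lists X" "y = \<phi> u" "z = \<phi> v"
      using \<phi>_surj by (metis imageE)
    then have "f (y \<otimes> z) = ?e (u @ v)"
      using f[of "u @ v"] by (simp add: \<phi>_append)
    also have "\<dots> = ?e u \<otimes>\<^bsub>N\<^esub> ?e v"
      using N.foldr_mult_append[OF pc pc, OF uv(1,2)] by simp
    finally show "f (y \<otimes> z) = f y \<otimes>\<^bsub>N\<^esub> f z"
      by (simp add: uv f)
  qed
  moreover have "f \<one> = \<one>\<^bsub>N\<^esub>"
    using f[of "[]"] by (simp add: \<phi>_Nil)
  moreover have "f a \<in> atoms N" if a: "a \<in> atoms K" for a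
    using atomsE[OF a] gen p by metis
  ultimately have "f \<in> atom_preserving_hom K N"
    by (simp add: atom_preserving_hom_iff f_def)
  with gen show ?thesis by blast
qed

end

lemma free_monoid_copy:
  assumes "copy_of (free_monoid X) F"
  obtains \<phi> where "length_two_quotient F X \<phi>" "inj_on \<phi> (lists X)"
proof -
  obtain \<phi> where "\<phi> \<in> hom (free_monoid X) F" "bij_betw \<phi> (lists X) (carrier F)"
    using copy_ofE[OF assms] by auto
  moreover have "monoid F" using assms by (simp add: copy_of_def)
  ultimately show ?thesis
    using that by (auto simp: length_two_quotient_def length_two_quotient_axioms_def
        bij_betw_def inj_on_def)
qed

text \<open>The counterpart of \<open>integer_group_copy\<close> for atoms: with \<open>t\<close>
  the image of the free generator, evaluation at \<open>t\<close> is a bijection from the morphisms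
  \<open>F\<close> to \<open>N\<close> onto the atoms of \<open>N\<close>.\<close>

lemma free_monoid_singleton_copy:
  assumes "copy_of (free_monoid {()}) F"
  obtains t where "atomic_monoid F"
    "\<And>(N :: ('n, 'c) monoid_scheme) f g. monoid N \<Longrightarrow> f \<in> atom_preserving_hom F N \<Longrightarrow>
       g \<in> atom_preserving_hom F N \<Longrightarrow> f t = g t \<Longrightarrow> f = g"
    "\<And>(N :: ('n, 'c) monoid_scheme) a. monoid N \<Longrightarrow> a \<in> atoms N \<Longrightarrow>
       \<exists>f \<in> atom_preserving_hom F N. f t = a"
    "t \<in> atoms F"
proof -
  obtain \<phi> where q: "length_two_quotient F {()} \<phi>" and inj: "inj_on \<phi> (lists {()})"
    using free_monoid_copy[OF assms] by blast
  interpret length_two_quotient F "{()}" \<phi> by (rule q)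
  show thesis
  proof (rule that)
    show "atomic_monoid F" by (rule atomic)
    show "\<phi> [()] \<in> atoms F" by (rule \<phi>_singleton_in_atoms) simp
  next
    fix N :: "('n, 'c) monoid_scheme" and f g
    assume fg: "f \<in> atom_preserving_hom F N" "g \<in> atom_preserving_hom F N"
      and eq: "f (\<phi> [()]) = g (\<phi> [()])"
    show "f = g"
    proof (rule atom_preserving_hom_eqI[OF atomic fg])
      show "f u = g u" if "u \<in> Units F" for u
        using that fg by (simp add: Units_eq atom_preserving_hom_iff)
      show "f a = g a" if "a \<in> atoms F" for a
        using atomsE[OF that] eq by auto
    qed
  next
    fix N :: "('n, 'c) monoid_scheme" and a
    assume "monoid N" and a: "a \<in> atoms N"
    then show "\<exists>f \<in> atom_preserving_hom F N. f (\<phi> [()]) = a"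
      using ex_atom_preserving_hom[of N "\<lambda>_. a"] inj by (auto dest: inj_onD)
  qed
qed

section \<open>Generated congruences and one-relator presentations\<close>

lemma monoid_congruence_refl:
  "monoid_congruence H r \<Longrightarrow> x \<in> carrier H \<Longrightarrow> (x, x) \<in> r"
  by (auto simp: monoid_congruence_def equiv_def refl_on_def)

lemma monoid_congruence_mult:
  "monoid_congruence H r \<Longrightarrow> (a, a') \<in> r \<Longrightarrow> (b, b') \<in> r \<Longrightarrow>
     (a \<otimes>\<^bsub>H\<^esub> b, a' \<otimes>\<^bsub>H\<^esub> b') \<in> r"
  unfolding monoid_congruence_def by blast

lemma generated_congruence_least:
  "monoid_congruence H r \<Longrightarrow> R \<subseteq> r \<Longrightarrow> generated_congruence H R \<subseteq> r"
  unfolding generated_congruence_def by blast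

lemma subset_generated_congruence: "R \<subseteq> generated_congruence H R"
  unfolding generated_congruence_def by blast

lemma monoid_congruence_full:
  assumes "monoid H"
  shows "monoid_congruence H (carrier H \<times> carrier H)"
proof -
  interpret monoid H by fact
  show ?thesis
    by (auto simp: monoid_congruence_def equiv_def refl_on_def sym_def trans_def)
qed

text \<open>The closure properties pass to intersections. Since \<open>R\<close> consists of pairs
  from the carrier, the full relation belongs to the intersected family and keeps the result inside
  the carrier.\<close>

lemma monoid_congruence_generated:
  assumes "monoid H" "R \<subseteq> carrier H \<times> carrier H"
  shows "monoid_congruence H (generated_congruence H R)"
proof -
  let ?S = "{r. monoid_congruence H r \<and> R \<subseteq> r}"
  let ?r = "generated_congruence H R"
  have sub: "?r \<subseteq> carrier H \<times> carrier H"
    by (intro generated_congruence_least monoid_congruence_full assms)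
  have "refl_on (carrier H) ?r"
    using sub by (auto simp: refl_on_def generated_congruence_def monoid_congruence_refl)
  moreover have "sym ?r"
    unfolding generated_congruence_def
    by (rule symI) (auto simp: monoid_congruence_def equiv_def dest: symD)
  moreover have "trans ?r"
    unfolding generated_congruence_def
    by (rule transI) (auto simp: monoid_congruence_def equiv_def dest: transD)
  moreover have "(a \<otimes>\<^bsub>H\<^esub> b, a' \<otimes>\<^bsub>H\<^esub> b') \<in> ?r" if "(a, a') \<in> ?r" "(b, b') \<in> ?r" for a a' b b'
    using that by (auto simp: generated_congruence_def intro: monoid_congruence_mult)
  ultimately show ?thesis
    using sub by (auto simp: monoid_congruence_def equiv_def)
qed

text \<open>The product of two classes is a union over all pairs of representatives. Compatibility
  makes all classes in this union equal, and reflexivity makes the union non-empty.\<close>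

lemma quotient_monoid_proj:
  assumes "monoid H" "monoid_congruence H r"
  shows "(\<lambda>x. r `` {x}) \<in> hom H (quotient_monoid H r)"
proof (rule homI)
  interpret monoid H by fact
  have eq: "equiv (carrier H) r" using assms(2) by (simp add: monoid_congruence_def)
  fix x assume x: "x \<in> carrier H"
  then show "r `` {x} \<in> carrier (quotient_monoid H r)"
    by (simp add: quotient_monoid_def quotientI)
  fix y assume y: "y \<in> carrier H"
  have "r `` {a \<otimes>\<^bsub>H\<^esub> b} = r `` {x \<otimes>\<^bsub>H\<^esub> y}" if "a \<in> r `` {x}" "b \<in> r `` {y}" for a b
    using that monoid_congruence_mult[OF assms(2), of x a y b] equiv_class_eq[OF eq] by fastforce
  moreover have "x \<in> r `` {x}" "y \<in> r `` {y}"
    using x y by (auto intro: monoid_congruence_refl[OF assms(2)])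
  ultimately have "(\<Union>a \<in> r `` {x}. \<Union>b \<in> r `` {y}. r `` {a \<otimes>\<^bsub>H\<^esub> b}) = r `` {x \<otimes>\<^bsub>H\<^esub> y}"
    by blast
  then show "r `` {x \<otimes>\<^bsub>H\<^esub> y} = r `` {x} \<otimes>\<^bsub>quotient_monoid H r\<^esub> r `` {y}"
    by (simp add: quotient_monoid_def)
qed

text \<open>Places the one-relator monoids in the scope of \<open>length_two_quotient\<close> and
  gives their universal property for assignments of atoms to the generators. Both parts bound the
  generated congruence from above by an explicit congruence \<open>s\<close>.\<close>

lemma M_pres_copy:
  fixes K :: "('u, 'd) monoid_scheme"
  assumes adm: "admissible n \<omega>1 \<omega>2" and copy: "copy_of (M_pres n \<omega>1 \<omega>2) K"
  obtains \<phi> where "length_two_quotient K {1..n} \<phi>" "\<phi> \<omega>1 = \<phi> \<omega>2"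
    "\<And>(N :: ('n, 'c) monoid_scheme) p. monoid N \<Longrightarrow> p ` {1..n} \<subseteq> atoms N \<Longrightarrow>
       foldr (mult N) (map p \<omega>1) \<one>\<^bsub>N\<^esub> = foldr (mult N) (map p \<omega>2) \<one>\<^bsub>N\<^esub> \<Longrightarrow>
       \<exists>f \<in> atom_preserving_hom K N. \<forall>i \<in> {1..n}. f (\<phi> [i]) = p i"
proof -
  let ?F = "free_monoid {1..n}"
  define r where "r = generated_congruence ?F {(\<omega>1, \<omega>2)}"
  have \<omega>: "\<omega>1 \<in> lists {1..n}" "\<omega>2 \<in> lists {1..n}" "2 \<le> length \<omega>1" "2 \<le> length \<omega>2"
    using adm by (auto simp: admissible_def)
  have r: "monoid_congruence ?F r"
    unfolding r_def using \<omega> by (intro monoid_congruence_generated monoid_free_monoid) simp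
  then have eq: "equiv (lists {1..n}) r"
    by (simp add: monoid_congruence_def)
  have Q: "M_pres n \<omega>1 \<omega>2 = quotient_monoid ?F r"
    by (simp add: M_pres_def presented_monoid_def r_def)
  obtain \<psi> where \<psi>: "\<psi> \<in> hom (quotient_monoid ?F r) K"
    and b: "bij_betw \<psi> (carrier (quotient_monoid ?F r)) (carrier K)"
    using copy_ofE[OF copy] unfolding Q by blast
  have cQ: "carrier (quotient_monoid ?F r) = (\<lambda>w. r `` {w}) ` lists {1..n}"
    by (auto simp: quotient_monoid_def quotient_def)
  \<comment> \<open>The projection of words to their classes, followed by the isomorphism onto the
    copy.\<close>
  define \<phi> where "\<phi> w = \<psi> (r `` {w})" for w
  have ker: "\<phi> u = \<phi> v \<longleftrightarrow> (u, v) \<in> r" if "u \<in> lists {1..n}" "v \<in> lists {1..n}" for u v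
  proof -
    have "\<phi> u = \<phi> v \<longleftrightarrow> r `` {u} = r `` {v}"
      unfolding \<phi>_def using that b cQ by (intro inj_on_eq_iff[of \<psi>]) (auto simp: bij_betw_def)
    then show ?thesis using eq_equiv_class_iff[OF eq that] by simp
  qed
  have K: "monoid K" using copy by (simp add: copy_of_def)
  have short: "u = v \<or> 2 \<le> length u \<and> 2 \<le> length v" if "(u, v) \<in> r" for u v
  proof -
    \<comment> \<open>Equality, enlarged by all pairs of words of length at least two. Concatenation
      cannot shorten words, so this is a congruence, and it contains the defining relation.\<close>
    define s where "s = {(u, v). u \<in> lists {1..n} \<and> v \<in> lists {1..n} \<and>
      (u = v \<or> 2 \<le> length u \<and> 2 \<le> length v)}"
    have "monoid_congruence ?F s"
      by (auto simp: monoid_congruence_def equiv_def refl_on_def sym_def trans_def s_def)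
    then have "r \<subseteq> s"
      unfolding r_def using \<omega> by (intro generated_congruence_least) (auto simp: s_def)
    with that show ?thesis by (auto simp: s_def)
  qed
  have lq: "length_two_quotient K {1..n} \<phi>"
  proof (intro length_two_quotient.intro length_two_quotient_axioms.intro K)
    show "\<phi> \<in> hom ?F K"
      using hom_compose[OF quotient_monoid_proj[OF monoid_free_monoid r] \<psi>]
      by (simp add: \<phi>_def[abs_def] comp_def)
    show "\<phi> ` lists {1..n} = carrier K"
      using b unfolding \<phi>_def bij_betw_def cQ image_image by blast
    show "u = v \<or> 2 \<le> length u \<and> 2 \<le> length v"
      if "u \<in> lists {1..n}" "v \<in> lists {1..n}" "\<phi> u = \<phi> v" for u v
      using that ker short by simp
  qed
  show thesis
  proof (rule that[OF lq])
    have "(\<omega>1, \<omega>2) \<in> r"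
      unfolding r_def using subset_generated_congruence by blast
    then show "\<phi> \<omega>1 = \<phi> \<omega>2" using ker \<omega> by simp
  next
    fix N :: "('n, 'c) monoid_scheme" and p
    assume N: "monoid N" and "p ` {1..n} \<subseteq> atoms N"
      and rel: "foldr (mult N) (map p \<omega>1) \<one>\<^bsub>N\<^esub> = foldr (mult N) (map p \<omega>2) \<one>\<^bsub>N\<^esub>"
    from this(2) have p: "p i \<in> atoms N" if "i \<in> {1..n}" for i using that by blast
    interpret N: monoid N by (rule N)
    let ?e = "\<lambda>w. foldr (mult N) (map p w) \<one>\<^bsub>N\<^esub>"
    \<comment> \<open>The kernel of the evaluation of words under \<open>p\<close>; by
      \<open>rel\<close> it contains the defining relation, hence all of \<open>r\<close>.\<close>
    define s where "s = {(u, v). u \<in> lists {1..n} \<and> v \<in> lists {1..n} \<and> ?e u = ?e v}"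
    have pc: "set (map p w) \<subseteq> carrier N" if "w \<in> lists {1..n}" for w
      using that by (auto intro!: atoms_closed p)
    have app: "?e (u @ v) = ?e u \<otimes>\<^bsub>N\<^esub> ?e v" if "u \<in> lists {1..n}" "v \<in> lists {1..n}" for u v
      using N.foldr_mult_append[OF pc pc, OF that] by simp
    have "equiv (lists {1..n}) s"
      by (auto simp: equiv_def refl_on_def sym_def trans_def s_def)
    moreover have "(a @ b, a' @ b') \<in> s" if "(a, a') \<in> s" "(b, b') \<in> s" for a a' b b'
      using that app[of a b] app[of a' b'] by (simp add: s_def)
    ultimately have "monoid_congruence ?F s"
      by (auto simp: monoid_congruence_def)
    then have rs: "r \<subseteq> s"
      unfolding r_def using \<omega> rel by (intro generated_congruence_least) (auto simp: s_def)
    show "\<exists>f \<in> atom_preserving_hom K N. \<forall>i \<in> {1..n}. f (\<phi> [i]) = p i"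
    proof (rule length_two_quotient.ex_atom_preserving_hom[OF lq N p])
      fix u v assume "u \<in> lists {1..n}" "v \<in> lists {1..n}" "\<phi> u = \<phi> v"
      then have "(u, v) \<in> s" using ker rs by blast
      then show "?e u = ?e v" by (simp add: s_def)
    qed
  qed
qed

section \<open>The generator property and its strength\<close>

theorem proposition2p4:
  fixes F G :: "'u monoid"
    and M :: "nat \<Rightarrow> nat list \<Rightarrow> nat list \<Rightarrow> 'u monoid"
  assumes "copy_of (free_monoid {()}) F"
    and "copy_of integer_group G"
    and "\<And>n \<omega>1 \<omega>2. admissible n \<omega>1 \<omega>2 \<Longrightarrow> copy_of (M_pres n \<omega>1 \<omega>2) (M n \<omega>1 \<omega>2)"
  shows "strong_generator AtoMon ({F, G} \<union> {M n \<omega>1 \<omega>2 | n \<omega>1 \<omega>2. admissible n \<omega>1 \<omega>2})"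
proof -
  let ?\<G> = "{F, G} \<union> {M n \<omega>1 \<omega>2 | n \<omega>1 \<omega>2. admissible n \<omega>1 \<omega>2}"
  obtain t where F: "atomic_monoid F" and t: "t \<in> atoms F"
    and F_eq: "\<And>(N :: 'u monoid) f g. monoid N \<Longrightarrow> f \<in> atom_preserving_hom F N \<Longrightarrow>
       g \<in> atom_preserving_hom F N \<Longrightarrow> f t = g t \<Longrightarrow> f = g"
    and F_ex: "\<And>(N :: 'u monoid) a. monoid N \<Longrightarrow> a \<in> atoms N \<Longrightarrow>
       \<exists>f \<in> atom_preserving_hom F N. f t = a"
    by (rule free_monoid_singleton_copy[OF assms(1)]) (rule that)
  obtain s where G: "atomic_monoid G" and s: "s \<in> Units G"
    and G_eq: "\<And>(N :: 'u monoid) f g. monoid N \<Longrightarrow> f \<in> atom_preserving_hom G N \<Longrightarrow>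
       g \<in> atom_preserving_hom G N \<Longrightarrow> f s = g s \<Longrightarrow> f = g"
    and G_ex: "\<And>(N :: 'u monoid) u. monoid N \<Longrightarrow> u \<in> Units N \<Longrightarrow>
       \<exists>f \<in> atom_preserving_hom G N. f s = u"
    by (rule integer_group_copy[OF assms(2)]) (rule that)
  have t': "t \<in> carrier F" and s': "s \<in> carrier G"
    using t s by (auto simp: atoms_def Units_def)
  have M: "atomic_monoid (M n \<omega>1 \<omega>2)" if adm: "admissible n \<omega>1 \<omega>2" for n \<omega>1 \<omega>2
    using M_pres_copy[OF adm assms(3)[OF adm]] length_two_quotient.atomic by metis
  have "generator AtoMon ?\<G>"
    unfolding generator_def AtoMon_simps mem_Collect_eq
  proof (intro conjI ballI impI)
    show "?\<G> \<subseteq> {H. atomic_monoid H}" using F G M by auto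
  next
    fix K K' :: "'u monoid" and f1 f2
    assume "K \<in> {H. atomic_monoid H}" "K' \<in> {H. atomic_monoid H}"
      and f: "f1 \<in> atom_preserving_hom K K'" "f2 \<in> atom_preserving_hom K K'" "f1 \<noteq> f2"
    then have K: "atomic_monoid K" "monoid K" by (auto dest: atomic_monoidD)
    \<comment> \<open>Distinct morphisms differ at a unit or at an atom; the first case is detected
      by \<open>G\<close>, the second by \<open>F\<close>.\<close>
    consider u where "u \<in> Units K" "f1 u \<noteq> f2 u" | a where "a \<in> atoms K" "f1 a \<noteq> f2 a"
      using atom_preserving_hom_eqI[OF K(1) f(1,2)] f(3) by blast
    then show "\<exists>H \<in> ?\<G>. \<exists>g \<in> atom_preserving_hom H K.
        compose (carrier H) f1 g \<noteq> compose (carrier H) f2 g"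
    proof cases
      case 1
      then obtain g where "g \<in> atom_preserving_hom G K" "g s = u" using G_ex K by blast
      moreover from this have "compose (carrier G) f1 g \<noteq> compose (carrier G) f2 g"
        using 1 s' by (metis compose_eq)
      ultimately show ?thesis by blast
    next
      case 2
      then obtain g where "g \<in> atom_preserving_hom F K" "g t = a" using F_ex K by blast
      moreover from this have "compose (carrier F) f1 g \<noteq> compose (carrier F) f2 g"
        using 2 t' by (metis compose_eq)
      ultimately show ?thesis by blast
    qed
  qed
  \<comment> \<open>Strength in contrapositive form: a monomorphism through which all morphisms from
    the family factor is an isomorphism.\<close>
  moreover have "isomorphism AtoMon L K m"
    if L: "atomic_monoid L" and K: "atomic_monoid K" and mono: "monomorphism AtoMon L K m"
      and factor: "\<And>H g. H \<in> ?\<G> \<Longrightarrow> g \<in> atom_preserving_hom H K \<Longrightarrow>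
        \<exists>h \<in> atom_preserving_hom H L. compose (carrier H) m h = g"
    for K L :: "'u monoid" and m
  proof -
    note L' = atomic_monoidD[OF L] and K' = atomic_monoidD[OF K]
    interpret L: monoid L by (rule L')
    interpret K: monoid K by (rule K')
    have m: "m \<in> atom_preserving_hom L K" using mono by (simp add: monomorphism_def)
    then have mh: "m \<in> hom L K" "m \<one>\<^bsub>L\<^esub> = \<one>\<^bsub>K\<^esub>" "\<And>a. a \<in> atoms L \<Longrightarrow> m a \<in> atoms K"
      by (auto simp: atom_preserving_hom_iff)
    have mc: "m x \<in> carrier K" if "x \<in> carrier L" for x
      using mh(1) that by (rule hom_in_carrier)
    have cancel: "g = h" if "atomic_monoid Z" "g \<in> atom_preserving_hom Z L"
      "h \<in> atom_preserving_hom Z L" "compose (carrier Z) m g = compose (carrier Z) m h"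
      for Z :: "'u monoid" and g h
      using mono that by (auto simp: monomorphism_def)
    \<comment> \<open>Represent \<open>u\<close> and \<open>v\<close> as values at \<open>s\<close>
      of morphisms from \<open>G\<close>. Their composites with \<open>m\<close> agree at
      \<open>s\<close>, hence everywhere, and the monomorphism \<open>m\<close> can be cancelled.
      For atoms, \<open>F\<close> and \<open>t\<close> take the place of \<open>G\<close> and
      \<open>s\<close>.\<close>
    have inj_units: "u = v" if uv: "u \<in> Units L" "v \<in> Units L" "m u = m v" for u v
    proof -
      obtain g h where gh: "g \<in> atom_preserving_hom G L" "g s = u"
        "h \<in> atom_preserving_hom G L" "h s = v"
        using G_ex[OF L'] uv by meson
      have "compose (carrier G) m g = compose (carrier G) m h"
        using G atom_preserving_hom_compose[OF G _ m] gh uv s'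
        by (intro G_eq[OF K']) (auto simp: compose_eq)
      with gh cancel[OF G] show ?thesis by blast
    qed
    have inj_atoms: "a = b" if ab: "a \<in> atoms L" "b \<in> atoms L" "m a = m b" for a b
    proof -
      obtain g h where gh: "g \<in> atom_preserving_hom F L" "g t = a"
        "h \<in> atom_preserving_hom F L" "h t = b"
        using F_ex[OF L'] ab by meson
      have "compose (carrier F) m g = compose (carrier F) m h"
        using F atom_preserving_hom_compose[OF F _ m] gh ab t'
        by (intro F_eq[OF K']) (auto simp: compose_eq)
      with gh cancel[OF F] show ?thesis by blast
    qed
    \<comment> \<open>The morphism from \<open>G\<close> with value \<open>u\<close> at
      \<open>s\<close> factors as \<open>m\<close> after \<open>h\<close>, so \<open>h s\<close> is
      a preimage of \<open>u\<close>. Atoms are treated in the same way with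
      \<open>F\<close>.\<close>
    have surj_units: "u \<in> m ` carrier L" if u: "u \<in> Units K" for u
    proof -
      obtain g where g: "g \<in> atom_preserving_hom G K" "g s = u" using G_ex[OF K' u] by blast
      then obtain h where h: "h \<in> atom_preserving_hom G L" "compose (carrier G) m h = g"
        using factor[of G g] by auto
      then have "m (h s) = u" using g s' by (metis compose_eq)
      moreover have "h s \<in> carrier L"
        using h s' by (auto simp: atom_preserving_hom_iff dest: hom_in_carrier)
      ultimately show ?thesis by blast
    qed
    have surj_atoms: "a \<in> m ` carrier L" if a: "a \<in> atoms K" for a
    proof -
      obtain g where g: "g \<in> atom_preserving_hom F K" "g t = a" using F_ex[OF K' a] by blast
      then obtain h where h: "h \<in> atom_preserving_hom F L" "compose (carrier F) m h = g"
        using factor[of F g] by auto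
      then have "m (h t) = a" using g t' by (metis compose_eq)
      moreover have "h t \<in> carrier L"
        using h t' by (auto simp: atom_preserving_hom_iff dest: hom_in_carrier)
      ultimately show ?thesis by blast
    qed
    have surj: "y \<in> m ` carrier L" if y: "y \<in> carrier K" for y
    proof (cases "y \<in> Units K")
      case False
      then obtain bs where bs: "set bs \<subseteq> atoms K" "y = foldr (mult K) bs \<one>\<^bsub>K\<^esub>"
        using atomic_monoidE[OF K y] by blast
      \<comment> \<open>Preimages are chosen factor by factor; they only have to lie in
        \<open>carrier L\<close>.\<close>
      then have "bs \<in> lists (m ` carrier L)" using surj_atoms by auto
      then obtain as where as: "bs = map m as" "set as \<subseteq> carrier L"
        unfolding lists_image by (auto simp: lists_eq_set)
      then have "y = m (foldr (mult L) as \<one>\<^bsub>L\<^esub>)"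
        using bs by (simp add: hom_foldr_mult[OF L' mh(1,2)])
      then show ?thesis using as L.foldr_mult_closed by blast
    qed (rule surj_units)
    have inj: "x = y" if xy: "x \<in> carrier L" "y \<in> carrier L" "m x = m y" for x y
    proof -
      \<comment> \<open>Since \<open>m\<close> preserves and reflects units and atoms,
        \<open>x\<close> and \<open>y\<close> are of the same kind, so the case distinction on
        \<open>x\<close> alone suffices.\<close>
      have Units_iff: "x \<in> Units L \<longleftrightarrow> y \<in> Units L"
        using atom_preserving_hom_Units_iff[OF L K' m] xy by metis
      have atoms_iff: "x \<in> atoms L \<longleftrightarrow> y \<in> atoms L"
        using atom_preserving_hom_atomsD[OF L K' m] xy mh(3) by metis
      consider "x \<in> Units L" | "x \<in> atoms L" | "x \<notin> Units L" "x \<notin> atoms L" by blast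
      then show ?thesis
      proof cases
        case 1
        then show ?thesis using Units_iff inj_units xy by blast
      next
        case 2
        then show ?thesis using atoms_iff inj_atoms xy by blast
      next
        case 3
        obtain as where as: "as \<noteq> []" "set as \<subseteq> atoms L" "x = foldr (mult L) as \<one>\<^bsub>L\<^esub>"
          using atomic_monoidE[OF L] 3 xy by blast
        obtain bs where bs: "bs \<noteq> []" "set bs \<subseteq> atoms L" "y = foldr (mult L) bs \<one>\<^bsub>L\<^esub>"
          using atomic_monoidE[OF L] 3 xy Units_iff by blast
        \<comment> \<open>A factorisation of a non-atom has at least two factors, as admissibility
          requires of the relation words.\<close>
        have length2: "2 \<le> length cs"
          if "cs \<noteq> []" "set cs \<subseteq> atoms L" "foldr (mult L) cs \<one>\<^bsub>L\<^esub> \<notin> atoms L" for cs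
        proof (rule ccontr)
          assume "\<not> 2 \<le> length cs"
          with that(1) obtain c where "cs = [c]" by (cases cs rule: list.exhaust) (auto simp: Suc_le_eq)
          with that show False using atoms_closed[of c L] by simp
        qed
        define n where "n = length as + length bs"
        \<comment> \<open>Generators are numbered from 1 but list positions from 0, hence the
          shift.\<close>
        define p where "p i = (as @ bs) ! (i - 1)" for i
        \<comment> \<open>The two words share no letter, so they are distinct even if
          \<open>as = bs\<close>, and \<open>p\<close> turns them into \<open>as\<close> and
          \<open>bs\<close>.\<close>
        define \<omega>1 where "\<omega>1 = [1..<Suc (length as)]"
        define \<omega>2 where "\<omega>2 = [Suc (length as)..<Suc n]"
        have l: "length \<omega>1 = length as" "length \<omega>2 = length bs"
          by (simp_all add: \<omega>1_def \<omega>2_def n_def del: upt_Suc)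
        have "1 \<in> set \<omega>1" "1 \<notin> set \<omega>2"
          using as(1) by (auto simp: \<omega>1_def \<omega>2_def Suc_le_eq simp del: upt_Suc)
        then have "\<omega>1 \<noteq> \<omega>2" by blast
        moreover have "2 \<le> length as" "2 \<le> length bs"
          using as bs length2[of as] length2[of bs] 3 atoms_iff by auto
        moreover have "\<omega>1 \<in> lists {1..n}" "\<omega>2 \<in> lists {1..n}"
          by (auto simp: \<omega>1_def \<omega>2_def n_def simp del: upt_Suc)
        ultimately have adm: "admissible n \<omega>1 \<omega>2"
          by (simp add: admissible_def l n_def)
        have p: "map p \<omega>1 = as" "map p \<omega>2 = bs"
          by (auto intro!: nth_equalityI
              simp: p_def \<omega>1_def \<omega>2_def n_def nth_append simp del: upt_Suc)
        have pa: "p i \<in> atoms L" if "i \<in> {1..n}" for i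
        proof -
          have "p i \<in> set (as @ bs)"
            unfolding p_def using that by (intro nth_mem) (auto simp: n_def)
          then show ?thesis using as bs by auto
        qed
        let ?M = "M n \<omega>1 \<omega>2"
        have \<omega>: "\<omega>1 \<in> lists {1..n}" "\<omega>2 \<in> lists {1..n}"
          using adm by (auto simp: admissible_def)
        obtain \<phi> where q: "length_two_quotient ?M {1..n} \<phi>" and rel: "\<phi> \<omega>1 = \<phi> \<omega>2"
          and ex: "\<And>(N :: 'u monoid) p. monoid N \<Longrightarrow> p ` {1..n} \<subseteq> atoms N \<Longrightarrow>
            foldr (mult N) (map p \<omega>1) \<one>\<^bsub>N\<^esub> = foldr (mult N) (map p \<omega>2) \<one>\<^bsub>N\<^esub> \<Longrightarrow>
            \<exists>f \<in> atom_preserving_hom ?M N. \<forall>i \<in> {1..n}. f (\<phi> [i]) = p i"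
          by (rule M_pres_copy[OF adm assms(3)[OF adm]]) (rule that)
        interpret q: length_two_quotient ?M "{1..n}" \<phi> by (rule q)
        \<comment> \<open>The assignment \<open>m \<circ> p\<close> respects the defining relation
          because the products of \<open>as\<close> and \<open>bs\<close> have the same image under
          \<open>m\<close>.\<close>
        have "\<exists>g \<in> atom_preserving_hom ?M K. \<forall>i \<in> {1..n}. g (\<phi> [i]) = (m \<circ> p) i"
        proof (rule ex[OF K'])
          show "(m \<circ> p) ` {1..n} \<subseteq> atoms K" using mh(3) pa by auto
          have "foldr (mult K) (map m as) \<one>\<^bsub>K\<^esub> = foldr (mult K) (map m bs) \<one>\<^bsub>K\<^esub>"
            using xy(3) as bs hom_foldr_mult[OF L' mh(1,2), of as]
              hom_foldr_mult[OF L' mh(1,2), of bs] by (auto simp: subset_eq atoms_closed)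
          then show "foldr (mult K) (map (m \<circ> p) \<omega>1) \<one>\<^bsub>K\<^esub> = foldr (mult K) (map (m \<circ> p) \<omega>2) \<one>\<^bsub>K\<^esub>"
            by (simp add: map_map[symmetric] p del: map_map)
        qed
        then obtain g where g: "g \<in> atom_preserving_hom ?M K" "\<forall>i \<in> {1..n}. g (\<phi> [i]) = m (p i)"
          by auto
        then obtain h where h: "h \<in> atom_preserving_hom ?M L" "compose (carrier ?M) m h = g"
          using factor[of ?M g] adm by blast
        \<comment> \<open>Both sides are atoms of \<open>L\<close> with the same image under
          \<open>m\<close>, so injectivity on atoms identifies them.\<close>
        have hp: "h (\<phi> [i]) = p i" if i: "i \<in> {1..n}" for i
        proof (rule inj_atoms)
          have a: "\<phi> [i] \<in> atoms ?M" using i by (rule q.\<phi>_singleton_in_atoms)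
          then show "h (\<phi> [i]) \<in> atoms L" using h by (simp add: atom_preserving_hom_iff)
          show "m (h (\<phi> [i])) = m (p i)"
            using h(2) g(2) i atoms_closed[OF a] by (metis compose_eq)
        qed (rule pa[OF i])
        have hw: "h (\<phi> w) = foldr (mult L) (map p w) \<one>\<^bsub>L\<^esub>" if "w \<in> lists {1..n}" for w
        proof -
          have "map (\<lambda>i. h (\<phi> [i])) w = map p w" using that hp by auto
          then show ?thesis using q.atom_preserving_hom_\<phi>[OF h(1) that] by (simp only:)
        qed
        \<comment> \<open>Evaluating \<open>h\<close> at the element
          \<open>\<phi> \<omega>1 = \<phi> \<omega>2\<close> gives the product of \<open>as\<close>
          on one side and that of \<open>bs\<close> on the other.\<close>
        show ?thesis
          using hw[OF \<omega>(1)] hw[OF \<omega>(2)] rel as(3) bs(3) p by simp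
      qed
    qed
    have "bij_betw m (carrier L) (carrier K)"
      using inj surj mc by (auto simp: bij_betw_def inj_on_def)
    then show ?thesis
      by (rule bijective_isomorphism_AtoMon[OF L K' m])
  qed
  ultimately show ?thesis
    unfolding strong_generator_def AtoMon_simps mem_Collect_eq by (intro conjI ballI allI impI) blast+
qed

end
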